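(* Let $\mathcal{F}$ be a family of graphs with $K_n, \overline{K_m} \in \mathcal{F}$ for some $n,m \in \mathbb{N}$. Then there is an optimal online algorithm with advice for the Delayed $\mathcal{F}$-Node-Deletion Problem that uses $O(\log \mathrm{opt})$ bits of advice.
   Context: Graphs are finite, simple, undirected, with at least one vertex (the graph left after deletions may be empty). $K_n$ is the complete graph on $n$ vertices and $\overline{K_m}$ the edgeless graph on $m$ vertices. $\log$ is base 2. A graph $G$ is $\mathcal{F}$-free if no $H\in\mathcal{F}$ is isomorphic to an induced subgraph of $G$. Delayed $\mathcal{F}$-Node-Deletion Problem: $\mathcal{F}$ is a fixed nonempty finite family of graphs such that no member is isomorphic to an induced subgraph of another, distinct member. An instance is a graph $G$ with an ordering $v_1,\dots,v_N$ of its vertices. In step $i$, vertex $v_i$ and its adjacencies to $v_1,\dots,v_{i-1}$ are revealed, and the algorithm (not knowing the future vertices or $N$) must output $S_i\subseteq\{v_1,\dots,v_i\}$ such that $G[\{v_1,\dots,v_i\}]-S_i$ is $\mathcal{F}$-free; moreover $S_1\subseteq\dots\subseteq S_N$. The goal is to minimize $|S_N|$. For an instance, $\mathrm{opt}$ is the minimum size of a set $S\subseteq V(G)$ with $G-S$ $\mathcal{F}$-free. An online algorithm with advice is deterministic, and additionally may sequentially read bits from an infinite binary tape. It is optimal if for every instance $I$ there is a tape content $\phi_I$ (chosen by an oracle knowing $I$) with which it outputs a solution of size $\mathrm{opt}(I)$ on $I$. It uses $b(\mathrm{opt})$ bits of advice if the $\phi_I$ can be chosen such that, additionally, at most $b(\mathrm{opt}(I))$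 tape bits are read on every instance $I$. The $O$-notation refers to $\mathrm{opt}\to\infty$ with constants depending only on $\mathcal{F}$. *)

theory Defs
  imports "Graph_Theory.Graph_Theory" "HOL-Library.Landau_Symbols"
begin

section \<open>Graphs and forbidden induced subgraphs\<close>

text \<open>
  Finite simple undirected graphs are the \<^locale>\<open>pair_graph\<close>s of the library, i.e. finite
  symmetric loop-free relations on a finite vertex set; \<^const>\<open>with_proj\<close> is a coercion
  into the general digraph type, on which induced subgraphs and isomorphisms are defined.
  The library admits the empty graph, so non-emptiness is required explicitly where needed.
\<close>

definition edgeless_digraph :: "nat \<Rightarrow> ('a, 'b) pre_digraph \<Rightarrow> bool" where
  "edgeless_digraph m G \<longleftrightarrow> graph G \<and> card (verts G) = m \<and> arcs G = {}"

definition iso_to_induced_subgraph :: "('a, 'b) pre_digraph \<Rightarrow> ('c, 'd) pre_digraph \<Rightarrow> bool" where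
  "iso_to_induced_subgraph H G \<longleftrightarrow> (\<exists>H'. induced_subgraph H' G \<and> digraph_iso H H')"

definition family_free :: "'a pair_pre_digraph set \<Rightarrow> ('c, 'd) pre_digraph \<Rightarrow> bool" where
  "family_free F G \<longleftrightarrow> \<not> (\<exists>H\<in>F. iso_to_induced_subgraph (with_proj H) G)"

definition forbidden_family :: "'a pair_pre_digraph set \<Rightarrow> bool" where
  "forbidden_family F \<longleftrightarrow>
     finite F \<and> F \<noteq> {} \<and>
     (\<forall>H\<in>F. pair_graph H \<and> pverts H \<noteq> {}) \<and>
     (\<forall>H\<in>F. \<forall>H'\<in>F. H \<noteq> H' \<longrightarrow> \<not> iso_to_induced_subgraph (with_proj H) (with_proj H'))"


section \<open>The Delayed Node-Deletion Problem\<close>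

text \<open>The list \<open>vs\<close> is the ordering \<open>v\<^sub>1, \<dots>, v\<^sub>N\<close>; thus \<open>take i vs\<close> lists \<open>v\<^sub>1, \<dots>, v\<^sub>i\<close>.\<close>

definition deletion_instance :: "'v pair_pre_digraph \<Rightarrow> 'v list \<Rightarrow> bool" where
  "deletion_instance G vs \<longleftrightarrow>
     pair_graph G \<and> pverts G \<noteq> {} \<and> distinct vs \<and> set vs = pverts G"

definition revealed :: "'v pair_pre_digraph \<Rightarrow> 'v list \<Rightarrow> nat \<Rightarrow> ('v, 'v \<times> 'v) pre_digraph" where
  "revealed G vs i = with_proj G \<restriction> set (take i vs)"

text \<open>Only the values \<open>S i\<close> with \<open>1 \<le> i \<le> N\<close> are relevant.\<close>

definition delayed_solution ::
    "'a pair_pre_digraph set \<Rightarrow> 'v pair_pre_digraph \<Rightarrow> 'v list \<Rightarrow> (nat \<Rightarrow> 'v set) \<Rightarrow> bool" where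
  "delayed_solution F G vs S \<longleftrightarrow>
     (\<forall>i\<in>{1..length vs}. S i \<subseteq> set (take i vs) \<and>
        family_free F (revealed G vs i \<restriction> (set (take i vs) - S i))) \<and>
     (\<forall>i\<in>{1..<length vs}. S i \<subseteq> S (Suc i))"

definition opt :: "'a pair_pre_digraph set \<Rightarrow> 'v pair_pre_digraph \<Rightarrow> nat" where
  "opt F G = Min {card S |S. S \<subseteq> pverts G \<and> family_free F (with_proj G \<restriction> (pverts G - S))}"


section \<open>Online algorithms with advice\<close>

text \<open>
  A deterministic algorithm is a function of everything it has seen so far: the vertices revealed
  up to now in their order of arrival, the graph induced by them, and the bits read up to now.
  It either asks for the next bit of the advice tape or outputs its set for the current step.
  Information about earlier steps (their inputs, outputs, and the times at which bits were read)
  can be recomputed from these arguments and is therefore not passed separately.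
\<close>

datatype 'v action = Read | Output "'v set"

type_synonym 'v advice_algorithm =
  "'v list \<Rightarrow> ('v, 'v \<times> 'v) pre_digraph \<Rightarrow> bool list \<Rightarrow> 'v action"

text \<open>
  \<open>advice_step A \<phi> xs R p q S\<close>: on revealed vertices \<open>xs\<close> and revealed graph \<open>R\<close>, and with \<open>p\<close> bits of
  the tape \<open>\<phi>\<close> read before, \<open>A\<close> outputs \<open>S\<close> after finitely many further reads, \<open>q\<close> bits then having
  been read in total.
\<close>

inductive advice_step ::
    "'v advice_algorithm \<Rightarrow> (nat \<Rightarrow> bool) \<Rightarrow> 'v list \<Rightarrow> ('v, 'v \<times> 'v) pre_digraph \<Rightarrow>
     nat \<Rightarrow> nat \<Rightarrow> 'v set \<Rightarrow> bool"
  for A \<phi> xs R where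
  emit: "A xs R (map \<phi> [0..<p]) = Output S \<Longrightarrow> advice_step A \<phi> xs R p p S"
| fetch: "A xs R (map \<phi> [0..<p]) = Read \<Longrightarrow> advice_step A \<phi> xs R (Suc p) q S \<Longrightarrow>
    advice_step A \<phi> xs R p q S"

text \<open>\<open>S i\<close> is the output in step \<open>i\<close>, and \<open>p i\<close> the number of bits read in steps \<open>1, \<dots>, i\<close>.\<close>

definition advice_run ::
    "'v advice_algorithm \<Rightarrow> (nat \<Rightarrow> bool) \<Rightarrow> 'v pair_pre_digraph \<Rightarrow> 'v list \<Rightarrow>
     (nat \<Rightarrow> nat) \<Rightarrow> (nat \<Rightarrow> 'v set) \<Rightarrow> bool" where
  "advice_run A \<phi> G vs p S \<longleftrightarrow> p 0 = 0 \<and>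
     (\<forall>i\<in>{1..length vs}. advice_step A \<phi> (take i vs) (revealed G vs i) (p (i - 1)) (p i) (S i))"

definition optimal_with_advice ::
    "'a pair_pre_digraph set \<Rightarrow> 'v advice_algorithm \<Rightarrow> (nat \<Rightarrow> nat) \<Rightarrow> bool" where
  "optimal_with_advice F A b \<longleftrightarrow>
     (\<forall>G vs. deletion_instance G vs \<longrightarrow>
       (\<exists>\<phi> p S. advice_run A \<phi> G vs p S \<and> delayed_solution F G vs S \<and>
          card (S (length vs)) = opt F G \<and> p (length vs) \<le> b (opt F G)))"

lemma advice_step_deterministic:
  assumes "advice_step A \<phi> xs R p q S" and "advice_step A \<phi> xs R p q' S'"
  shows "q' = q \<and> S' = S"
  using assms
proof (induction arbitrary: q' S' rule: advice_step.induct)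
  case (emit p S)
  from emit(2) show ?case
    by cases (simp_all add: emit(1))
next
  case (fetch p q S)
  from fetch(4) have "advice_step A \<phi> xs R (Suc p) q' S'"
    by cases (simp_all add: fetch(1))
  then show ?case by (rule fetch.IH)
qed

end

theory Submission
  imports Defs "HOL-Library.Ramsey" "HOL-Real_Asymp.Real_Asymp"
begin

text \<open>
  By Ramsey's theorem an \<open>F\<close>-free graph has fewer than \<open>r\<close> vertices for a constant \<open>r\<close>, so an optimal
  solution keeps fewer than \<open>r\<close> vertices and the number \<open>N\<close> of all vertices is less than \<open>opt + r\<close>.
  With \<open>L = O(log opt)\<close> such that \<open>N < 2\<^sup>L\<close>, the advice is \<open>1\<^sup>L 0\<close> followed by \<open>r\<close> blocks of \<open>L\<close> bits,
  which list the positions of the kept vertices in the order of arrival. The prefix \<open>1\<^sup>L 0\<close> tells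
  the algorithm when to stop reading. It then deletes every arriving vertex that is not listed; what
  remains at any time is an induced subgraph of the final graph, hence \<open>F\<close>-free.
\<close>

section \<open>Induced subgraphs and Ramsey's theorem\<close>

lemma induce_subgraph_induce_subgraph:
  assumes "B \<subseteq> A"
  shows "(G \<restriction> A) \<restriction> B = G \<restriction> B"
  using assms by (auto simp: induce_subgraph_def)

text \<open>Heredity: an induced subgraph of the smaller restriction is also one of the larger. This
  carries freeness of the final kept graph back to every earlier step.\<close>

lemma family_free_induce_subgraph_mono:
  assumes "wf_digraph G" "X \<subseteq> verts G" "Y \<subseteq> X" "family_free F (G \<restriction> X)"
  shows "family_free F (G \<restriction> Y)"
proof -
  have "induced_subgraph K (G \<restriction> X)" if "induced_subgraph K (G \<restriction> Y)" for K
  proof -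
    have "wf_digraph (G \<restriction> X)"
      using assms(1) by (rule wf_digraph.wellformed_induce_subgraph)
    then show ?thesis
      using that assms(3) unfolding induced_subgraph_def subgraph_def compatible_def by auto
  qed
  then show ?thesis
    using assms(4) unfolding family_free_def iso_to_induced_subgraph_def by blast
qed

text \<open>Reduces library isomorphisms, which also map arcs, to an injective vertex map that
  preserves and reflects adjacency. Both Ramsey cases below use this form.\<close>

lemma iso_to_induced_subgraph_restrictI:
  fixes H :: "'a pair_pre_digraph" and G :: "'v pair_pre_digraph"
  assumes H: "wf_digraph (with_proj H)" and G: "wf_digraph (with_proj G)"
    and inj: "inj_on f (pverts H)" and sub: "f ` pverts H \<subseteq> X"
    and arcs: "\<And>u v. u \<in> pverts H \<Longrightarrow> v \<in> pverts H \<Longrightarrow> (u, v) \<in> parcs H \<longleftrightarrow> (f u, f v) \<in> parcs G"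
  shows "iso_to_induced_subgraph (with_proj H) (with_proj G \<restriction> X)"
proof -
  \<comment> \<open>Arcs are vertex pairs, so the vertex map dictates the arc map. Keeping
    \<open>fst\<close> as tail and \<open>snd\<close> as head makes the image literally a
    restriction of \<open>with_proj G\<close>.\<close>
  define hom where "hom = \<lparr>iso_verts = f, iso_arcs = (\<lambda>(u, v). (f u, f v)), iso_head = snd, iso_tail = fst\<rparr>"
  have H': "u \<in> pverts H" "v \<in> pverts H" if "(u, v) \<in> parcs H" for u v
    using wf_digraph.tail_in_verts[OF H, of "(u, v)"] wf_digraph.head_in_verts[OF H, of "(u, v)"] that
    by auto
  have "inj_on (\<lambda>(u, v). (f u, f v)) (parcs H)"
    by (rule inj_onI) (use H' inj in \<open>auto dest: inj_onD\<close>)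
  then have iso: "pre_digraph.digraph_isomorphism (with_proj H) hom"
    unfolding pre_digraph.digraph_isomorphism_def hom_def using H inj by auto
  have eq: "app_iso hom (with_proj H) = with_proj G \<restriction> (f ` pverts H)"
  proof -
    have "(\<lambda>(u, v). (f u, f v)) ` parcs H = {e \<in> parcs G. fst e \<in> f ` pverts H \<and> snd e \<in> f ` pverts H}"
    proof (intro set_eqI iffI)
      fix e assume "e \<in> (\<lambda>(u, v). (f u, f v)) ` parcs H"
      then obtain u v where "(u, v) \<in> parcs H" "e = (f u, f v)" by auto
      then show "e \<in> {e \<in> parcs G. fst e \<in> f ` pverts H \<and> snd e \<in> f ` pverts H}"
        using H'[of u v] arcs[of u v] by simp
    next
      fix e assume "e \<in> {e \<in> parcs G. fst e \<in> f ` pverts H \<and> snd e \<in> f ` pverts H}"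
      then obtain u v where "u \<in> pverts H" "v \<in> pverts H" "(f u, f v) \<in> parcs G" "e = (f u, f v)"
        by (cases e) auto
      then show "e \<in> (\<lambda>(u, v). (f u, f v)) ` parcs H"
        using arcs[of u v] by (intro image_eqI[of _ _ "(u, v)"]) auto
    qed
    then show ?thesis
      by (simp add: app_iso_def hom_def induce_subgraph_def)
  qed
  have "induced_subgraph (with_proj G \<restriction> (f ` pverts H)) (with_proj G \<restriction> X)"
    using sub G
    by (auto simp: induced_subgraph_def subgraph_def compatible_def wf_digraph.wellformed_induce_subgraph)
  with iso eq show ?thesis
    unfolding iso_to_induced_subgraph_def digraph_iso_def by metis
qed

text \<open>Take \<open>r\<close> to be a Ramsey number for \<open>n\<close> and \<open>m\<close>:
  any \<open>r\<close> vertices contain a clique of size \<open>n\<close> or an independent set of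
  size \<open>m\<close>, hence a copy of a member of \<open>F\<close>. The choice of
  \<open>r\<close> precedes \<open>G\<close>, so the bound is uniform.\<close>

lemma family_free_card_bounded:
  fixes F :: "'a pair_pre_digraph set"
  assumes "\<exists>H\<in>F. complete_digraph n (with_proj H)"
    and "\<exists>H\<in>F. edgeless_digraph m (with_proj H)"
  obtains r :: nat where "r \<ge> 1"
    and "\<And>(G :: 'v pair_pre_digraph) X. pair_graph G \<Longrightarrow> X \<subseteq> pverts G \<Longrightarrow>
           family_free F (with_proj G \<restriction> X) \<Longrightarrow> card X < r"
proof -
  obtain H\<^sub>1 where H\<^sub>1: "H\<^sub>1 \<in> F" "complete_digraph n (with_proj H\<^sub>1)"
    using assms(1) by blast
  obtain H\<^sub>2 where H\<^sub>2: "H\<^sub>2 \<in> F" "edgeless_digraph m (with_proj H\<^sub>2)"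
    using assms(2) by blast
  interpret H1: pair_graph H\<^sub>1
    using H\<^sub>1 by (intro pair_graphI_graph) (simp add: complete_digraph_def)
  interpret H2: pair_graph H\<^sub>2
    using H\<^sub>2 by (intro pair_graphI_graph) (simp add: edgeless_digraph_def)
  obtain r where r: "r \<ge> 1" "\<And>(V :: 'v set) E. finite V \<Longrightarrow> r \<le> card V \<Longrightarrow>
      \<exists>R\<subseteq>V. card R = n \<and> clique R E \<or> card R = m \<and> indep R E"
    using ramsey2[where 'a = 'v, of n m] by blast
  have "card X < r" if G: "pair_graph G" and X: "X \<subseteq> pverts G"
    and free: "family_free F (with_proj G \<restriction> X)" for G :: "'v pair_pre_digraph" and X
  proof (rule ccontr)
    assume "\<not> card X < r"
    interpret G: pair_graph G by (rule G)
    have fin: "finite X" using X G.pair_finite_verts by (rule finite_subset)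
    \<comment> \<open>\<open>ramsey2\<close> speaks of unordered edges; symmetry of \<open>G\<close>
      makes the translation lossless.\<close>
    define E where "E = {{u, v} |u v. (u, v) \<in> parcs G}"
    have E: "{u, v} \<in> E \<longleftrightarrow> (u, v) \<in> parcs G" for u v
      using G.arcs_symmetric by (auto simp: E_def doubleton_eq_iff)
    obtain R where R: "R \<subseteq> X" "card R = n \<and> clique R E \<or> card R = m \<and> indep R E"
      using r(2)[OF fin, of E] \<open>\<not> card X < r\<close> by auto
    have finR: "finite R" using R(1) fin by (rule finite_subset)
    from R(2) have "\<exists>H\<in>F. iso_to_induced_subgraph (with_proj H) (with_proj G \<restriction> X)"
    proof (elim disjE conjE)
      assume *: "card R = n" "clique R E"
      have "card (pverts H\<^sub>1) = card R" and arcs: "parcs H\<^sub>1 = {(u, v). u \<in> pverts H\<^sub>1 \<and> v \<in> pverts H\<^sub>1 \<and> u \<noteq> v}"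
        using H\<^sub>1(2) * by (auto simp: complete_digraph_pair_def)
      then obtain f where f: "bij_betw f (pverts H\<^sub>1) R"
        using finite_same_card_bij[OF H1.pair_finite_verts finR] by blast
      have "iso_to_induced_subgraph (with_proj H\<^sub>1) (with_proj G \<restriction> X)"
      proof (rule iso_to_induced_subgraph_restrictI)
        fix u v assume uv: "u \<in> pverts H\<^sub>1" "v \<in> pverts H\<^sub>1"
        then have "f u \<in> R" "f v \<in> R" "f u = f v \<longleftrightarrow> u = v"
          using f by (auto simp: bij_betw_def inj_on_def)
        then show "(u, v) \<in> parcs H\<^sub>1 \<longleftrightarrow> (f u, f v) \<in> parcs G"
          using uv arcs *(2) E by (auto simp: clique_def dest: G.no_loops')
      qed (use f R(1) in \<open>auto simp: bij_betw_def intro: H1.wf_digraph_axioms G.wf_digraph_axioms\<close>)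
      with H\<^sub>1(1) show ?thesis by blast
    next
      assume *: "card R = m" "indep R E"
      have "card (pverts H\<^sub>2) = card R" and arcs: "parcs H\<^sub>2 = {}"
        using H\<^sub>2(2) * by (auto simp: edgeless_digraph_def)
      then obtain f where f: "bij_betw f (pverts H\<^sub>2) R"
        using finite_same_card_bij[OF H2.pair_finite_verts finR] by blast
      have "iso_to_induced_subgraph (with_proj H\<^sub>2) (with_proj G \<restriction> X)"
      proof (rule iso_to_induced_subgraph_restrictI)
        fix u v assume uv: "u \<in> pverts H\<^sub>2" "v \<in> pverts H\<^sub>2"
        then have "f u \<in> R" "f v \<in> R"
          using f by (auto simp: bij_betw_def)
        then show "(u, v) \<in> parcs H\<^sub>2 \<longleftrightarrow> (f u, f v) \<in> parcs G"
          using arcs *(2) E G.no_loops' unfolding indep_def by (metis empty_iff)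
      qed (use f R(1) in \<open>auto simp: bij_betw_def intro: H2.wf_digraph_axioms G.wf_digraph_axioms\<close>)
      with H\<^sub>2(1) show ?thesis by blast
    qed
    with free show False by (simp add: family_free_def)
  qed
  with r(1) show thesis by (rule that)
qed

text \<open>Deleting all vertices is feasible because members of \<open>F\<close> are nonempty, so
  the minimum ranges over a nonempty finite set.\<close>

lemma opt_attained:
  assumes "pair_graph G" and "\<forall>H\<in>F. pverts H \<noteq> {}"
  obtains S where "S \<subseteq> pverts G" "family_free F (with_proj G \<restriction> (pverts G - S))" "card S = opt F G"
proof -
  let ?C = "{card S |S. S \<subseteq> pverts G \<and> family_free F (with_proj G \<restriction> (pverts G - S))}"
  interpret pair_graph G by fact
  have "?C \<subseteq> card ` Pow (pverts G)" by auto
  then have "finite ?C" by (rule finite_subset) (simp add: pair_finite_verts)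
  have "family_free F (with_proj G \<restriction> (pverts G - pverts G))"
    using assms(2)
    by (fastforce simp: family_free_def iso_to_induced_subgraph_def digraph_iso_def
        induced_subgraph_def subgraph_def)
  then have "?C \<noteq> {}" by blast
  with \<open>finite ?C\<close> have "opt F G \<in> ?C" unfolding opt_def by (rule Min_in)
  with that show thesis by auto
qed


section \<open>The advice\<close>

lemma ex_image_eq_if_card_le:
  assumes "finite A" "finite B" "card A \<le> card B" "A \<noteq> {}"
  shows "\<exists>f. f ` B = A"
proof -
  obtain a where a: "a \<in> A" using assms(4) by blast
  obtain g where g: "g ` A \<subseteq> B" "inj_on g A"
    using card_le_inj[OF assms(1-3)] by blast
  \<comment> \<open>A left inverse of the injection \<open>g\<close>, with the default
    \<open>a\<close> outside its image.\<close>
  define f where "f t = (if t \<in> g ` A then inv_into A g t else a)" for t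
  have "f ` B \<subseteq> A" using a by (auto simp: f_def inv_into_into)
  moreover have "x \<in> f ` B" if "x \<in> A" for x
    using that g by (intro image_eqI[of _ _ "g x"]) (auto simp: f_def)
  ultimately show ?thesis by blast
qed

text \<open>Recovers \<open>L\<close> from the unary prefix. Before the terminating zero is read, it
  is just the number of bits read.\<close>

definition header :: "bool list \<Rightarrow> nat" where
  "header bs = length (takeWhile id bs)"

text \<open>Block \<open>j\<close> starts after \<open>header bs\<close> ones and one zero, least
  significant bit first. The bound on \<open>i\<close> makes these bits determine
  \<open>i\<close>.\<close>

definition listed :: "nat \<Rightarrow> bool list \<Rightarrow> nat set" where
  "listed r bs = {i. i < 2 ^ header bs \<and>
     (\<exists>j<r. \<forall>k<header bs. bs ! (Suc (header bs) + j * header bs + k) = bit i k)}"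

text \<open>The full advice has \<open>L + 1 + r * L\<close> bits, one more than
  \<open>Suc r * L\<close>. During the run of ones the test always demands another bit, so the same
  test covers prefix and blocks.\<close>

definition keep_listed :: "nat \<Rightarrow> 'v advice_algorithm" where
  "keep_listed r xs R bs =
     (if length bs \<le> Suc r * header bs then Read
      else Output {xs ! i |i. i < length xs \<and> i \<notin> listed r bs})"

definition tape :: "nat \<Rightarrow> (nat \<Rightarrow> nat) \<Rightarrow> nat \<Rightarrow> bool" where
  "tape L f t \<longleftrightarrow> t < L \<or> L < t \<and> bit (f ((t - Suc L) div L)) ((t - Suc L) mod L)"

text \<open>The first zero is at position \<open>L\<close>. The value on every prefix of the tape is
  needed to see that reading does not stop early.\<close>

lemma header_tape: "header (map (tape L f) [0..<p]) = min p L"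
proof (induction p)
  case 0
  then show ?case by (simp add: header_def)
next
  case (Suc p)
  have L: "tape L f t \<longleftrightarrow> t < L" if "t \<le> L" for t
    using that by (auto simp: tape_def)
  show ?case
  proof (cases "p \<le> L")
    case True
    then have "takeWhile id (map (tape L f) [0..<p] @ [tape L f p]) =
        map (tape L f) [0..<p] @ takeWhile id [tape L f p]"
      by (intro takeWhile_append2) (auto simp: L)
    then show ?thesis
      using True L[of p] by (auto simp: header_def)
  next
    case False
    then have "False \<in> set (map (tape L f) [0..<p])"
      using L[of L] by (auto simp: image_iff intro!: bexI[of _ L])
    then have "takeWhile id (map (tape L f) [0..<p] @ [tape L f p]) =
        takeWhile id (map (tape L f) [0..<p])"
      by (rule takeWhile_append1) simp
    then show ?thesis
      using False Suc by (simp add: header_def)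
  qed
qed

lemma eq_iff_bits_below:
  fixes a b :: nat
  assumes "a < 2 ^ L" "b < 2 ^ L"
  shows "a = b \<longleftrightarrow> (\<forall>k<L. bit a k = bit b k)"
proof -
  have "take_bit L a = a" "take_bit L b = b"
    using assms by (simp_all add: take_bit_nat_eq_self)
  then show ?thesis
    by (metis bit_eqI bit_take_bit_iff)
qed

lemma listed_tape:
  assumes "\<And>j. j < r \<Longrightarrow> f j < 2 ^ L"
  shows "listed r (map (tape L f) [0..<Suc (Suc r * L)]) = f ` {..<r}"
proof -
  let ?bs = "map (tape L f) [0..<Suc (Suc r * L)]"
  have header: "header ?bs = L" unfolding header_tape by simp
  have bs: "?bs ! (Suc L + j * L + k) = bit (f j) k" if "j < r" "k < L" for j k
  proof -
    \<comment> \<open>Block \<open>j\<close> ends no later than the last block, so all its bits have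
      been read.\<close>
    have "Suc j * L \<le> r * L" using that(1) by (intro mult_right_mono) auto
    then have "Suc L + j * L + k < Suc (Suc r * L)" using that(2) by simp
    then have "?bs ! (Suc L + j * L + k) = tape L f (Suc L + j * L + k)"
      by (subst nth_map) (simp_all del: upt_Suc)
    also have "\<dots> = bit (f j) k" using that(2) by (simp add: tape_def)
    finally show ?thesis .
  qed
  have "i \<in> listed r ?bs \<longleftrightarrow> i < 2 ^ L \<and> (\<exists>j<r. \<forall>k<L. bit (f j) k = bit i k)" for i
    unfolding listed_def header mem_Collect_eq using bs by metis
  also have "\<dots> i \<longleftrightarrow> i \<in> f ` {..<r}" for i
    using assms eq_iff_bits_below[of _ L i] by (auto simp: image_iff)
  finally show ?thesis by blast
qed

section \<open>Runs of the algorithm and validity of its outputs\<close>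

lemma advice_step_readI:
  assumes "p \<le> q" and "\<And>t. p \<le> t \<Longrightarrow> t < q \<Longrightarrow> A xs R (map \<phi> [0..<t]) = Read"
    and "A xs R (map \<phi> [0..<q]) = Output S"
  shows "advice_step A \<phi> xs R p q S"
  using assms
proof (induction rule: inc_induct)
  case base
  then show ?case by (auto intro: advice_step.emit)
next
  case (step t)
  then show ?case by (auto intro: advice_step.fetch[of A xs R \<phi> t])
qed

text \<open>The stopping test depends only on the bits read, so step 1 fetches the whole advice and
  later steps decode the same bits again.\<close>

lemma advice_run_keep_listed:
  assumes "\<And>j. j < r \<Longrightarrow> f j < 2 ^ L" and "L > 0"
  shows "advice_run (keep_listed r) (tape L f) G vs
    (\<lambda>i. if i = 0 then 0 else Suc (Suc r * L))
    (\<lambda>i. {vs ! j |j. j < min i (length vs) \<and> j \<notin> f ` {..<r}})"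
  unfolding advice_run_def
proof (intro conjI ballI)
  fix i assume i: "i \<in> {1..length vs}"
  then have "i \<noteq> 0" by simp
  let ?q = "Suc (Suc r * L)"
  show "advice_step (keep_listed r) (tape L f) (take i vs) (revealed G vs i)
      (if i - 1 = 0 then 0 else ?q) (if i = 0 then 0 else ?q)
      {vs ! j |j. j < min i (length vs) \<and> j \<notin> f ` {..<r}}"
  \<comment> \<open>For \<open>i > 1\<close> both bit counts equal \<open>?q\<close>, so there is
    nothing to read.\<close>
  proof (rule advice_step_readI)
    fix t assume "t < (if i = 0 then 0 else ?q)"
    then have "t < ?q" using i by simp
    \<comment> \<open>This is the \<open>Read\<close> condition: the header is \<open>t\<close>
      within the prefix and \<open>L\<close> after it.\<close>
    then have "t \<le> Suc r * min t L" by (cases "t \<le> L") auto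
    then show "keep_listed r (take i vs) (revealed G vs i) (map (tape L f) [0..<t]) = Read"
      by (simp add: keep_listed_def header_tape)
  next
    have "keep_listed r (take i vs) (revealed G vs i) (map (tape L f) [0..<?q]) =
        Output {take i vs ! j |j. j < length (take i vs) \<and> j \<notin> f ` {..<r}}"
      using listed_tape[of r f L, OF assms(1)]
      by (simp add: keep_listed_def header_tape min_absorb2 del: upt_Suc)
    also have "{take i vs ! j |j. j < length (take i vs) \<and> j \<notin> f ` {..<r}} =
        {vs ! j |j. j < min i (length vs) \<and> j \<notin> f ` {..<r}}"
      by (auto simp: min.commute) (metis nth_take)
    finally show "keep_listed r (take i vs) (revealed G vs i)
        (map (tape L f) [0..<if i = 0 then 0 else ?q]) =
        Output {vs ! j |j. j < min i (length vs) \<and> j \<notin> f ` {..<r}}"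
      using \<open>i \<noteq> 0\<close> by (simp only: if_False)
  qed auto
qed auto

text \<open>The vertices kept so far always lie in \<open>pverts G - S\<close>, so heredity
  applies.\<close>

lemma delayed_solution_prefixes:
  assumes "pair_graph G" "distinct vs" "set vs = pverts G"
    and "S \<subseteq> pverts G" "family_free F (with_proj G \<restriction> (pverts G - S))"
  shows "delayed_solution F G vs (\<lambda>i. set (take i vs) \<inter> S)"
proof -
  interpret pair_graph G by fact
  have "family_free F (revealed G vs i \<restriction> (set (take i vs) - set (take i vs) \<inter> S))" for i
  proof -
    have "set (take i vs) - set (take i vs) \<inter> S \<subseteq> pverts G - S"
      using assms(3) set_take_subset[of i vs] by auto
    then have "family_free F (with_proj G \<restriction> (set (take i vs) - set (take i vs) \<inter> S))"
      by (rule family_free_induce_subgraph_mono[OF wf_digraph_axioms _ _ assms(5), rotated]) simp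
    then show ?thesis
      unfolding revealed_def by (subst induce_subgraph_induce_subgraph) auto
  qed
  moreover have "set (take i vs) \<subseteq> set (take (Suc i) vs)" for i
    by (rule set_take_subset_set_take) simp
  ultimately show ?thesis
    unfolding delayed_solution_def by blast
qed


section \<open>Logarithmic length of the advice\<close>

definition block_length :: "nat \<Rightarrow> nat \<Rightarrow> nat" where
  "block_length r k = nat \<lceil>log 2 (real (k + r))\<rceil>"

text \<open>With \<open>k\<close> the optimum, \<open>k + r\<close> exceeds the number of vertices,
  so every position fits into one block.\<close>

lemma le_two_power_block_length:
  assumes "r \<ge> 1"
  shows "k + r \<le> 2 ^ block_length r k"
proof -
  have "real (k + r) = 2 powr log 2 (real (k + r))" using assms by simp
  also have "\<dots> \<le> 2 powr real (block_length r k)"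
    unfolding block_length_def by (intro powr_mono) linarith+
  also have "\<dots> = real (2 ^ block_length r k)" by (simp add: powr_realpow)
  finally show ?thesis by (simp only: of_nat_le_iff)
qed

lemma block_length_bigo:
  assumes "r \<ge> 1"
  shows "(\<lambda>k. real (Suc (Suc r * block_length r k))) \<in> O(\<lambda>k. log 2 (real k))"
proof -
  have "(\<lambda>k. real (block_length r k)) \<in> O(\<lambda>k. log 2 (real k + real r) + 1)"
  proof (intro bigoI[where c = 1] always_eventually allI)
    fix k
    \<comment> \<open>Nonnegativity lets \<open>nat\<close> and the norms be dropped; rounding up
      then costs at most 1.\<close>
    have "log 2 (real k + real r) \<ge> 0" using assms by simp
    then show "norm (real (block_length r k)) \<le> 1 * norm (log 2 (real k + real r) + 1)"
      unfolding block_length_def by (simp add: ceiling_correct)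
  qed
  also have "(\<lambda>k. log 2 (real k + real r) + 1) \<in> O(\<lambda>k. log 2 (real k))" by real_asymp
  finally have "(\<lambda>k. real (Suc r) * real (block_length r k)) \<in> O(\<lambda>k. log 2 (real k))"
    by simp
  moreover have "(\<lambda>k. 1 :: real) \<in> O(\<lambda>k. log 2 (real k))" by real_asymp
  ultimately have "(\<lambda>k. 1 + real (Suc r) * real (block_length r k)) \<in> O(\<lambda>k. log 2 (real k))"
    by (rule sum_in_bigo(1)[rotated])
  then show ?thesis by (simp add: algebra_simps)
qed

theorem theorem6:
  fixes F :: "'a pair_pre_digraph set" and n m :: nat
  assumes "forbidden_family F"
    and "\<exists>H\<in>F. complete_digraph n (with_proj H)"
    and "\<exists>H\<in>F. edgeless_digraph m (with_proj H)"
  shows "\<exists>(A :: 'v advice_algorithm) (b :: nat \<Rightarrow> nat).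
           optimal_with_advice F A b \<and> (\<lambda>k. real (b k)) \<in> O(\<lambda>k. log 2 (real k))"
proof -
  obtain r :: nat where r: "r \<ge> 1" "\<And>(G :: 'v pair_pre_digraph) X. pair_graph G \<Longrightarrow>
      X \<subseteq> pverts G \<Longrightarrow> family_free F (with_proj G \<restriction> X) \<Longrightarrow> card X < r"
    using family_free_card_bounded[OF assms(2,3)] by blast
  define b where "b k = Suc (Suc r * block_length r k)" for k
  have "optimal_with_advice F (keep_listed r :: 'v advice_algorithm) b"
    unfolding optimal_with_advice_def
  proof (intro allI impI)
    fix G :: "'v pair_pre_digraph" and vs
    assume "deletion_instance G vs"
    then have G: "pair_graph G" and vs: "pverts G \<noteq> {}" "distinct vs" "set vs = pverts G"
      by (auto simp: deletion_instance_def)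
    obtain S where S: "S \<subseteq> pverts G" "family_free F (with_proj G \<restriction> (pverts G - S))"
      "card S = opt F G"
      using opt_attained[OF G, of F] assms(1) by (auto simp: forbidden_family_def)
    define N where "N = length vs"
    define L where "L = block_length r (opt F G)"
    define K where "K = {j. j < N \<and> vs ! j \<notin> S}"
    have D: "card (pverts G - S) < r" using r(2)[OF G _ S(2)] by blast
    \<comment> \<open>Together with \<open>D\<close> this gives \<open>N < opt F G + r\<close>,
      which ties the block length to the optimum instead of to \<open>N\<close>.\<close>
    have "N = card S + card (pverts G - S)"
    proof -
      have "finite (pverts G)" "card (pverts G) = N"
        using vs(3) distinct_card[OF vs(2)] by (auto simp: N_def simp flip: vs(3))
      then show ?thesis
        using S(1) card_mono[of "pverts G" S] by (simp add: card_Diff_subset finite_subset)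
    qed
    then have "N < 2 ^ L"
      using D S(3) le_two_power_block_length[OF r(1), of "opt F G"] by (simp add: L_def)
    have "N > 0" using vs by (auto simp: N_def)
    with \<open>N < 2 ^ L\<close> have "L > 0" by (cases L) auto
    have "card K \<le> card (pverts G - S)"
    proof (rule card_inj_on_le)
      show "inj_on ((!) vs) K"
        using vs(2) by (rule inj_on_nth) (simp add: K_def N_def)
      show "(!) vs ` K \<subseteq> pverts G - S"
        unfolding vs(3)[symmetric] by (auto simp: K_def N_def)
      show "finite (pverts G - S)" by (simp flip: vs(3))
    qed
    have "finite K" by (simp add: K_def)
    \<comment> \<open>The position \<open>N\<close>, at which no vertex arrives, pads the list when fewer than \<open>r\<close> vertices are kept.\<close>
    obtain f where f: "f ` {..<r} = insert N K"
    proof -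
      \<comment> \<open>The strict bound in \<open>D\<close> leaves room for the padding value
        \<open>N\<close>, which also keeps the listed set nonempty when \<open>K\<close> is
        empty.\<close>
      have "card (insert N K) \<le> card {..<r}"
        using \<open>finite K\<close> \<open>card K \<le> card (pverts G - S)\<close> D by (simp add: card_insert_if)
      with \<open>finite K\<close> have "\<exists>f. f ` {..<r} = insert N K"
        by (intro ex_image_eq_if_card_le) auto
      with that show thesis by blast
    qed
    have "f j < 2 ^ L" if "j < r" for j
    proof -
      have "f j \<in> insert N K" using f that by blast
      then show ?thesis using \<open>N < 2 ^ L\<close> by (auto simp: K_def)
    qed
    then have run: "advice_run (keep_listed r) (tape L f) G vs
        (\<lambda>i. if i = 0 then 0 else Suc (Suc r * L))
        (\<lambda>i. {vs ! j |j. j < min i (length vs) \<and> j \<notin> f ` {..<r}})"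
      using \<open>L > 0\<close> by (rule advice_run_keep_listed)
    \<comment> \<open>As \<open>N\<close> is not the position of a vertex, the unlisted positions
      below \<open>N\<close> are exactly those of \<open>S\<close>.\<close>
    have out: "{vs ! j |j. j < min i (length vs) \<and> j \<notin> f ` {..<r}} = set (take i vs) \<inter> S" for i
    proof -
      have "set (take i vs) = (!) vs ` {0..<min i (length vs)}"
        by (cases "i \<le> length vs") (simp_all add: nth_image min_def)
      then show ?thesis
        unfolding f by (auto simp: K_def N_def)
    qed
    have "card (set (take (length vs) vs) \<inter> S) = opt F G"
      using S(1,3) vs(3) by (simp add: Int_absorb1)
    moreover have "(if length vs = 0 then 0 else Suc (Suc r * L)) \<le> b (opt F G)"
      by (simp add: b_def L_def)
    ultimately show "\<exists>\<phi> p S. advice_run (keep_listed r) \<phi> G vs p S \<and> delayed_solution F G vs S \<and>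
        card (S (length vs)) = opt F G \<and> p (length vs) \<le> b (opt F G)"
      using run[unfolded out] delayed_solution_prefixes[OF G vs(2,3) S(1,2)] by blast
  qed
  moreover have "(\<lambda>k. real (b k)) \<in> O(\<lambda>k. log 2 (real k))"
    unfolding b_def using r(1) by (rule block_length_bigo)
  ultimately show ?thesis by blast
qed

end
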